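(* $H^3_{\rm TQ}(R_3;R_3)\neq 0$.
   Context: Let $\Lambda=\mathbb{Z}[T,T^{-1}]$. The dihedral quandle $R_3$ is $\mathbb{Z}_3=\mathbb{Z}/3\mathbb{Z}$ with $a*b=2b-a$; as a coefficient group $R_3$ is the $\Lambda$-module $\mathbb{Z}_3$ with $T$ acting as multiplication by $-1$. For a quandle $X$, a $\Lambda$-module $A$ and $n\ge 1$, let $C^n_{\rm TQ}(X;A)$ be the $\Lambda$-module of functions $f:X^n\to A$ with $f(x_1,\dots,x_n)=0$ whenever $x_i=x_{i+1}$ for some $i\in\{1,\dots,n-1\}$, and define $\delta:C^n_{\rm TQ}(X;A)\to C^{n+1}_{\rm TQ}(X;A)$ by $$(\delta f)(x_1,\dots,x_{n+1})=(-1)^n\sum_{i=1}^{n+1}(-1)^i\big[T f(x_1,\dots,\widehat{x_i},\dots,x_{n+1})-f(x_1*x_i,\dots,x_{i-1}*x_i,x_{i+1},\dots,x_{n+1})\big].$$ $Z^n_{\rm TQ}(X;A)=\ker\delta$, $B^n_{\rm TQ}(X;A)=\operatorname{im}(\delta:C^{n-1}_{\rm TQ}\to C^n_{\rm TQ})$, $H^n_{\rm TQ}=Z^n_{\rm TQ}/B^n_{\rm TQ}$. *)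

theory Defs
  imports
    "HOL-Library.Poly_Mapping"
    "HOL-Library.Numeral_Type"
    "HOL-Library.FuncSet"
    "HOL-Algebra.Module"
    "HOL-Algebra.AbelCoset"
    "HOL-Algebra.Algebraic_Closure_Type"
begin

text \<open>
  The Laurent polynomial ring \<open>\<Lambda> = \<int>[T, T\<inverse>]\<close> is the group ring of the infinite cyclic group
  of exponents: finitely supported functions from \<open>int\<close> to \<open>int\<close> under convolution.
\<close>

type_synonym laurent = "int \<Rightarrow>\<^sub>0 int"

abbreviation Laurent_ring :: "laurent ring" where
  "Laurent_ring \<equiv> ring_of_type_algebra"

definition laurent_T :: laurent where
  "laurent_T = Poly_Mapping.single 1 1"

lemma laurent_T_invertible: "laurent_T * Poly_Mapping.single (- 1) 1 = 1"
  by (simp add: laurent_T_def mult_single)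


locale quandle =
  fixes op :: "'x \<Rightarrow> 'x \<Rightarrow> 'x"
  assumes idem: "op a a = a"
    and bij_right: "bij (\<lambda>a. op a b)"
    and self_distrib: "op (op a b) c = op (op a c) (op b c)"


subsection \<open>Twisted quandle cochains\<close>

text \<open>
  Elements of \<open>X\<^sup>n\<close> are lists of length \<open>n\<close>; list positions count from 0, so \<open>x\<^sub>i\<close> is
  \<open>xs ! (i - 1)\<close>. Cochains are extensional functions on these lists. The quandle \<open>X\<close> is a whole
  type with operation \<open>op\<close>, and the coefficients \<open>A\<close> form a module over \<^term>\<open>Laurent_ring\<close>.
\<close>

definition tuples :: "nat \<Rightarrow> 'x list set" where
  "tuples n = {xs. length xs = n}"

definition TQ_cochain_set :: "(laurent, 'a, 'm) module_scheme \<Rightarrow> nat \<Rightarrow> ('x list \<Rightarrow> 'a) set" where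
  "TQ_cochain_set A n =
     {f \<in> tuples n \<rightarrow>\<^sub>E carrier A.
        \<forall>xs \<in> tuples n. (\<exists>i \<in> {1..<n}. xs ! (i - 1) = xs ! i) \<longrightarrow> f xs = \<zero>\<^bsub>A\<^esub>}"

text \<open>
  The module record of HOL-Algebra extends the ring record; its multiplicative fields play no
  role for modules and are left unspecified.
\<close>

definition TQ_cochains ::
    "(laurent, 'a, 'm) module_scheme \<Rightarrow> nat \<Rightarrow> (laurent, 'x list \<Rightarrow> 'a) module" where
  "TQ_cochains A n =
     \<lparr>carrier = TQ_cochain_set A n, monoid.mult = undefined, one = undefined,
      zero = (\<lambda>xs \<in> tuples n. \<zero>\<^bsub>A\<^esub>),
      add = (\<lambda>f g. \<lambda>xs \<in> tuples n. f xs \<oplus>\<^bsub>A\<^esub> g xs),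
      module.smult = (\<lambda>r f. \<lambda>xs \<in> tuples n. r \<odot>\<^bsub>A\<^esub> f xs)\<rparr>"

definition omit :: "nat \<Rightarrow> 'x list \<Rightarrow> 'x list" where
  "omit i xs = take (i - 1) xs @ drop i xs"

definition act_omit :: "('x \<Rightarrow> 'x \<Rightarrow> 'x) \<Rightarrow> nat \<Rightarrow> 'x list \<Rightarrow> 'x list" where
  "act_omit op i xs = map (\<lambda>x. op x (xs ! (i - 1))) (take (i - 1) xs) @ drop i xs"

definition TQ_coboundary ::
    "('x \<Rightarrow> 'x \<Rightarrow> 'x) \<Rightarrow> (laurent, 'a, 'm) module_scheme \<Rightarrow> nat \<Rightarrow>
      ('x list \<Rightarrow> 'a) \<Rightarrow> 'x list \<Rightarrow> 'a" where
  "TQ_coboundary op A n f =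
     (\<lambda>xs \<in> tuples (n + 1).
        (- 1) ^ n \<odot>\<^bsub>A\<^esub>
          (\<Oplus>\<^bsub>A\<^esub>i \<in> {1..n + 1}.
             (- 1) ^ i \<odot>\<^bsub>A\<^esub> (laurent_T \<odot>\<^bsub>A\<^esub> f (omit i xs) \<ominus>\<^bsub>A\<^esub> f (act_omit op i xs))))"

definition TQ_cocycles ::
    "('x \<Rightarrow> 'x \<Rightarrow> 'x) \<Rightarrow> (laurent, 'a, 'm) module_scheme \<Rightarrow> nat \<Rightarrow>
      (laurent, 'x list \<Rightarrow> 'a) module" where
  "TQ_cocycles op A n =
     (TQ_cochains A n)
       \<lparr>carrier := {f \<in> carrier (TQ_cochains A n).
                     TQ_coboundary op A n f = \<zero>\<^bsub>TQ_cochains A (n + 1)\<^esub>}\<rparr>"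

text \<open>
  Cochains are considered in degrees \<open>n \<ge> 1\<close> only, so the coboundaries below are meant
  for \<open>n \<ge> 2\<close>.
\<close>

definition TQ_coboundaries ::
    "('x \<Rightarrow> 'x \<Rightarrow> 'x) \<Rightarrow> (laurent, 'a, 'm) module_scheme \<Rightarrow> nat \<Rightarrow> ('x list \<Rightarrow> 'a) set" where
  "TQ_coboundaries op A n = TQ_coboundary op A (n - 1) ` carrier (TQ_cochains A (n - 1))"

text \<open>Quotient of a module by a submodule, in the style of \<^const>\<open>FactRing\<close>.\<close>

definition quotient_module ::
    "('r, 'a, 'm) module_scheme \<Rightarrow> 'a set \<Rightarrow> ('r, 'a set) module" where
  "quotient_module M N =
     \<lparr>carrier = a_rcosets\<^bsub>M\<^esub> N, monoid.mult = undefined, one = undefined,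
      zero = N, add = set_add M,
      module.smult = (\<lambda>r U. \<Union>u \<in> U. N +>\<^bsub>M\<^esub> (r \<odot>\<^bsub>M\<^esub> u))\<rparr>"

definition TQ_cohomology ::
    "('x \<Rightarrow> 'x \<Rightarrow> 'x) \<Rightarrow> (laurent, 'a, 'm) module_scheme \<Rightarrow> nat \<Rightarrow>
      (laurent, ('x list \<Rightarrow> 'a) set) module" where
  "TQ_cohomology op A n = quotient_module (TQ_cocycles op A n) (TQ_coboundaries op A n)"


subsection \<open>The dihedral quandle \<open>R\<^sub>3\<close>\<close>

text \<open>\<open>\<int>/3\<int>\<close> is the type \<^typ>\<open>3\<close>, on which arithmetic is modulo 3.\<close>

definition R3_op :: "3 \<Rightarrow> 3 \<Rightarrow> 3" where
  "R3_op a b = 2 * b - a"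

text \<open>A Laurent polynomial acts through its value at \<open>T = -1\<close>; note \<open>(-1)\<^sup>k = (-1)\<^bsup>\<bar>k\<bar>\<^esup>\<close>.\<close>

definition eval_minus_one :: "laurent \<Rightarrow> 'a::ring_1" where
  "eval_minus_one r =
     (\<Sum>k \<in> Poly_Mapping.keys r. of_int (Poly_Mapping.lookup r k) * (- 1) ^ nat \<bar>k\<bar>)"

definition R3_module :: "(laurent, 3) module" where
  "R3_module =
     \<lparr>carrier = UNIV, monoid.mult = (*), one = 1, zero = 0, add = (+),
      module.smult = (\<lambda>r a. eval_minus_one r * a)\<rparr>"

lemma quandle_R3: "quandle R3_op"
proof
  fix a b c :: 3
  show "R3_op a a = a" by (simp add: R3_op_def)
  have "R3_op (R3_op a b) b = a" for a by (simp add: R3_op_def)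
  then show "bij (\<lambda>a. R3_op a b)" by (intro o_bij[where g = "\<lambda>a. R3_op a b"]) auto
  show "R3_op (R3_op a b) c = R3_op (R3_op a c) (R3_op b c)"
    by (simp add: R3_op_def algebra_simps)
qed

lemma eval_minus_one_superset:
  assumes "finite K" "Poly_Mapping.keys r \<subseteq> K"
  shows "eval_minus_one r =
    (\<Sum>k \<in> K. of_int (Poly_Mapping.lookup r k) * (- 1) ^ nat \<bar>k\<bar> :: 'a::ring_1)"
  unfolding eval_minus_one_def using assms
  by (intro sum.mono_neutral_left) (auto simp: in_keys_iff)

lemma eval_minus_one_add:
  "eval_minus_one (r + s) = (eval_minus_one r + eval_minus_one s :: 'a::ring_1)"
proof -
  let ?K = "Poly_Mapping.keys r \<union> Poly_Mapping.keys s"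
  have "Poly_Mapping.keys (r + s) \<subseteq> ?K" by (rule keys_add)
  then show ?thesis
    by (simp add: eval_minus_one_superset[of ?K] lookup_add algebra_simps sum.distrib)
qed

lemma eval_minus_one_diff:
  "eval_minus_one (r - s) = (eval_minus_one r - eval_minus_one s :: 'a::ring_1)"
  using eval_minus_one_add[of "r - s" s, where 'a = 'a] by (simp add: algebra_simps)

lemma eval_minus_one_single:
  "eval_minus_one (Poly_Mapping.single k c) = (of_int c * (- 1) ^ nat \<bar>k\<bar> :: 'a::ring_1)"
  by (cases "c = 0") (simp_all add: eval_minus_one_def)

lemma eval_minus_one_laurent_T [simp]: "eval_minus_one laurent_T = (- 1 :: 'a::ring_1)"
  by (simp add: laurent_T_def eval_minus_one_single)

lemma eval_minus_one_0 [simp]: "eval_minus_one 0 = (0 :: 'a::ring_1)"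
  by (simp add: eval_minus_one_def)

lemma eval_minus_one_1 [simp]: "eval_minus_one 1 = (1 :: 'a::ring_1)"
  using eval_minus_one_single[of 0 1, where 'a = 'a] by simp

lemma minus_one_power_abs_add:
  "(- 1 :: 'a::ring_1) ^ nat \<bar>j + k\<bar> = (- 1) ^ nat \<bar>j\<bar> * (- 1) ^ nat \<bar>k\<bar>"
  by (simp add: minus_one_power_iff even_nat_iff)

lemma eval_minus_one_mult:
  "eval_minus_one (r * s) = (eval_minus_one r * eval_minus_one s :: 'a::comm_ring_1)"
proof -
  have single: "eval_minus_one (frag_of j * frag_of k) =
      (eval_minus_one (frag_of j) * eval_minus_one (frag_of k) :: 'a)" for j k
    by (simp add: mult_single eval_minus_one_single minus_one_power_abs_add)
  have left: "eval_minus_one (frag_of j * s) =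
      (eval_minus_one (frag_of j) * eval_minus_one s :: 'a)" for j
    by (rule frag_induction[where c = s and S = UNIV])
      (simp_all only: subset_UNIV mult_zero_right eval_minus_one_0 single
        right_diff_distrib eval_minus_one_diff)
  show ?thesis
    by (rule frag_induction[where c = r and S = UNIV])
      (simp_all only: subset_UNIV mult_zero_left eval_minus_one_0 left
        left_diff_distrib eval_minus_one_diff)
qed

lemma module_R3: "module Laurent_ring R3_module"
proof (rule moduleI)
  show "cring Laurent_ring" by (rule cring_from_type_algebra)
  have "\<exists>y. y + x = 0" for x :: 3
    by (rule exI[of _ "- x"]) simp
  then show "abelian_group R3_module"
    by (intro abelian_groupI) (auto simp: R3_module_def algebra_simps)
qed (simp_all add: R3_module_def ring_of_type_algebra_def eval_minus_one_add
    eval_minus_one_mult distrib_left distrib_right mult.assoc)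

lemma laurent_T_smult_R3: "laurent_T \<odot>\<^bsub>R3_module\<^esub> a = - a"
  by (simp add: R3_module_def)

end

theory Submission
  imports Defs
begin

text \<open>
  A class is detected by an explicit cocycle. On \<open>R\<^sub>3\<^sup>3\<close> put \<open>f(x, y, z) = (y - x)\<^sup>2 (z - y)\<close>, which
  vanishes on degenerate triples. Because \<open>T\<close> acts as \<open>-1\<close>, each summand of \<open>\<delta>f\<close> is, up to sign,
  the sum of the two faces belonging to one index. In terms of the differences \<open>p, q, r\<close> of
  consecutive entries of a quadruple these sums are \<open>2q\<^sup>2r\<close>,
  \<open>((p + q)\<^sup>2 + (q - p)\<^sup>2)r = 2(p\<^sup>2 + q\<^sup>2)r\<close>, \<open>p\<^sup>2((q + r) + (r - q)) = 2p\<^sup>2r\<close> and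
  \<open>p\<^sup>2q + (-p)\<^sup>2(-q) = 0\<close>, so their alternating sum vanishes: \<open>f\<close> is a cocycle
  (\<open>R3_witness_cocycle\<close>).

  For every 2-cochain \<open>g\<close> the value \<open>(\<delta>g)(0, y, 0) = g(0, y) + g(0, -y) - g(y, 0) - g(-y, 0)\<close> is
  an even function of \<open>y\<close> (\<open>R3_coboundary_symmetric\<close>), whereas \<open>f(0, y, 0) = -y\<^sup>3 = -y\<close> is not even.
  Hence \<open>f\<close> is not a coboundary and its coset is nonzero.
\<close>

lemma eval_minus_one_minus_one_power:
  "eval_minus_one ((- 1) ^ n) = ((- 1) ^ n :: 'a::comm_ring_1)"
proof (induction n)
  case (Suc n)
  have "eval_minus_one (- 1 :: laurent) = (- 1 :: 'a)"
    using eval_minus_one_diff[of 0 1, where 'a = 'a] by simp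
  with Suc show ?case
    by (simp only: power_Suc eval_minus_one_mult)
qed simp

lemma R3_minus_one_power_smult: "(- 1) ^ n \<odot>\<^bsub>R3_module\<^esub> a = (- 1) ^ n * a"
  by (simp add: R3_module_def eval_minus_one_minus_one_power)

lemma R3_module_selectors:
  "carrier R3_module = UNIV" "\<zero>\<^bsub>R3_module\<^esub> = 0" "a \<oplus>\<^bsub>R3_module\<^esub> b = a + b"
  by (simp_all add: R3_module_def)

lemma R3_minus: "a \<ominus>\<^bsub>R3_module\<^esub> b = a - b"
proof -
  interpret R3: module Laurent_ring R3_module by (rule module_R3)
  have "\<ominus>\<^bsub>R3_module\<^esub> b = - b"
    by (rule R3.minus_equality) (simp_all add: R3_module_def)
  then show ?thesis
    by (simp add: a_minus_def R3_module_def)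
qed

lemma R3_finsum:
  assumes "finite I"
  shows "finsum R3_module h I = sum h I"
proof -
  interpret R3: module Laurent_ring R3_module by (rule module_R3)
  from assms show ?thesis
    by induction (simp_all add: R3_module_selectors)
qed

text \<open>Since \<open>T\<close> acts as \<open>-1\<close>, the two faces with the same index enter with the same sign.\<close>

lemma R3_coboundary:
  assumes "length xs = n + 1"
  shows "TQ_coboundary R3_op R3_module n f xs =
    - ((- 1) ^ n * (\<Sum>i = 1..n + 1. (- 1) ^ i * (f (omit i xs) + f (act_omit R3_op i xs))))"
proof -
  have "(- 1) ^ i * (- a - b) = - ((- 1) ^ i * (a + b))" for i :: nat and a b :: 3
    by (simp add: algebra_simps)
  with assms show ?thesis
    by (simp add: TQ_coboundary_def tuples_def R3_finsum R3_minus R3_minus_one_power_smult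
        laurent_T_smult_R3 sum_negf del: sum.cl_ivl_Suc)
qed

text \<open>
  The cochain \<open>(x, y, z) \<mapsto> (y - x)\<^sup>2 (z - y)\<close>. Without the square it would still be a cocycle, but
  a coboundary.
\<close>

definition R3_witness :: "3 list \<Rightarrow> 3" where
  "R3_witness = (\<lambda>xs \<in> tuples 3. (xs ! 1 - xs ! 0)\<^sup>2 * (xs ! 2 - xs ! 1))"

lemma R3_witness_Cons: "R3_witness [x, y, z] = (y - x)\<^sup>2 * (z - y)"
  by (simp add: R3_witness_def tuples_def)

lemma R3_witness_cochain: "R3_witness \<in> TQ_cochain_set R3_module 3"
proof -
  have "i = 1 \<or> i = 2" if "i \<in> {1..<3}" for i :: nat
    using that by auto
  then show ?thesis
    by (fastforce simp: TQ_cochain_set_def R3_witness_def R3_module_def)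
qed

lemma R3_witness_coboundary_Cons:
  "TQ_coboundary R3_op R3_module 3 R3_witness [x, y, z, w] = 0"
proof -
  have "{1..3 + 1} = {1, 2, 3, 4 :: nat}"
    by auto
  then have "TQ_coboundary R3_op R3_module 3 R3_witness [x, y, z, w] =
      - ((z - y)\<^sup>2 * (w - z) + (z - y)\<^sup>2 * (w - z))
      + ((z - x)\<^sup>2 * (w - z) + (z - (2 * y - x))\<^sup>2 * (w - z))
      - ((y - x)\<^sup>2 * (w - y) + ((2 * z - y) - (2 * z - x))\<^sup>2 * (w - (2 * z - y)))
      + ((y - x)\<^sup>2 * (z - y)
        + ((2 * w - y) - (2 * w - x))\<^sup>2 * ((2 * w - z) - (2 * w - y)))"
    by (simp add: R3_coboundary omit_def act_omit_def R3_op_def R3_witness_Cons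
        numeral_3_eq_3 numeral_eq_Suc)
  also have "\<dots> = 0"
    by (simp add: power2_eq_square algebra_simps)
  finally show ?thesis .
qed

lemma R3_witness_cocycle: "R3_witness \<in> carrier (TQ_cocycles R3_op R3_module 3)"
proof -
  have "TQ_coboundary R3_op R3_module 3 R3_witness = (\<lambda>xs \<in> tuples 4. 0)"
  proof
    fix xs :: "3 list"
    show "TQ_coboundary R3_op R3_module 3 R3_witness xs = (\<lambda>xs \<in> tuples 4. 0) xs"
    proof (cases "length xs = 4")
      case True
      then obtain x y z w where "xs = [x, y, z, w]"
        by (auto simp: numeral_eq_Suc length_Suc_conv)
      with R3_witness_coboundary_Cons show ?thesis
        by (simp add: tuples_def)
    next
      case False
      then show ?thesis
        by (simp add: TQ_coboundary_def tuples_def)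
    qed
  qed
  with R3_witness_cochain show ?thesis
    by (simp add: TQ_cocycles_def TQ_cochains_def R3_module_def)
qed

lemma R3_coboundary_symmetric:
  assumes "g \<in> TQ_cochain_set R3_module 2"
  shows "TQ_coboundary R3_op R3_module 2 g [0, - y, 0] =
    TQ_coboundary R3_op R3_module 2 g [0, y, 0]"
proof -
  have "\<exists>i \<in> {1..<2}. [0, 0 :: 3] ! (i - 1) = [0, 0] ! i"
    by (rule bexI[of _ 1]) simp_all
  with assms have degenerate: "g [0, 0] = 0"
    by (simp add: TQ_cochain_set_def tuples_def R3_module_def)
  have "{1..2 + 1} = {1, 2, 3 :: nat}"
    by auto
  then have "TQ_coboundary R3_op R3_module 2 g [0, u, 0] =
      2 * g [u, 0] - g [2 * u, 0] + g [0, u] + g [0, - u]" for u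
    by (simp add: R3_coboundary omit_def act_omit_def R3_op_def degenerate numeral_eq_Suc)
  moreover have "2 * u = - u" for u :: 3
  proof -
    have "(2 :: 3) = - 1"
      by simp
    then show ?thesis
      by (simp only: mult_minus1)
  qed
  ultimately have "TQ_coboundary R3_op R3_module 2 g [0, u, 0] =
      - g [u, 0] - g [- u, 0] + g [0, u] + g [0, - u]" for u
    by (simp only:)
  then show ?thesis
    by simp
qed

lemma R3_witness_not_coboundary: "R3_witness \<notin> TQ_coboundaries R3_op R3_module 3"
proof
  assume "R3_witness \<in> TQ_coboundaries R3_op R3_module 3"
  then obtain g where "g \<in> TQ_cochain_set R3_module 2"
    and "R3_witness = TQ_coboundary R3_op R3_module 2 g"
    by (auto simp: TQ_coboundaries_def TQ_cochains_def)
  then have "R3_witness [0, - 1, 0] = R3_witness [0, 1, 0]"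
    by (metis R3_coboundary_symmetric)
  then show False
    by (simp add: R3_witness_Cons)
qed

lemma zero_in_R3_coboundaries:
  "(\<lambda>xs \<in> tuples 3. 0) \<in> TQ_coboundaries R3_op R3_module 3"
proof -
  let ?z = "\<lambda>xs \<in> tuples 2. 0 :: 3"
  have "?z \<in> TQ_cochain_set R3_module 2"
    by (simp add: TQ_cochain_set_def R3_module_def)
  moreover have "TQ_coboundary R3_op R3_module 2 ?z = (\<lambda>xs \<in> tuples 3. 0)"
  proof
    fix xs :: "3 list"
    show "TQ_coboundary R3_op R3_module 2 ?z xs = (\<lambda>xs \<in> tuples 3. 0) xs"
    proof (cases "length xs = 3")
      case True
      then have "?z (omit i xs) = 0" "?z (act_omit R3_op i xs) = 0" if "i \<in> {1..2 + 1}" for i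
        using that by (auto simp: omit_def act_omit_def tuples_def)
      with True show ?thesis
        by (simp add: R3_coboundary tuples_def del: sum.cl_ivl_Suc)
    next
      case False
      then show ?thesis
        by (simp add: TQ_coboundary_def tuples_def)
    qed
  qed
  ultimately show ?thesis
    by (force simp: TQ_coboundaries_def TQ_cochains_def)
qed

theorem proposition6p4:
  shows "carrier (TQ_cohomology R3_op R3_module 3) \<noteq> {\<zero>\<^bsub>TQ_cohomology R3_op R3_module 3\<^esub>}"
proof
  let ?Z = "TQ_cocycles R3_op R3_module 3" and ?B = "TQ_coboundaries R3_op R3_module 3"
  assume "carrier (TQ_cohomology R3_op R3_module 3) = {\<zero>\<^bsub>TQ_cohomology R3_op R3_module 3\<^esub>}"
  then have "a_rcosets\<^bsub>?Z\<^esub> ?B = {?B}"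
    by (simp add: TQ_cohomology_def quotient_module_def)
  then have coset: "?B +>\<^bsub>?Z\<^esub> R3_witness = ?B"
    using R3_witness_cocycle by (auto simp: A_RCOSETS_def')
  have "(\<lambda>xs \<in> tuples 3. 0) \<oplus>\<^bsub>?Z\<^esub> R3_witness = R3_witness"
    by (auto simp: TQ_cocycles_def TQ_cochains_def R3_module_def R3_witness_def)
  with zero_in_R3_coboundaries have "R3_witness \<in> ?B +>\<^bsub>?Z\<^esub> R3_witness"
    by (force simp: a_r_coset_def')
  with coset R3_witness_not_coboundary show False
    by simp
qed

end
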